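(* Let $\mathbb{F}$ be a field of characteristic $p>0$ with algebraic closure $\overline{\mathbb{F}}$. There is an algorithm which takes as input a nonzero polynomial $f(X)\in\mathbb{F}_p(t)[X]$ and outputs a natural number $m$ such that any root of $f$ in $\overline{\mathbb{F}}((t^{\mathbb{Q}}))$ is already in $\mathbb{F}_{p^m}((t^{\mathbb{Q}}))$.
   Context: For a field $K$, $K((t^{\mathbb{Q}}))$ denotes the Hahn field of generalised power series $\sum_{\gamma}a_\gamma t^\gamma$ with $a_\gamma\in K$ and well-ordered support $\{\gamma\in\mathbb{Q}\mid a_\gamma\ne0\}$; $\mathbb{F}_p(t)$ is viewed as a subfield in the natural way. $\mathbb{F}_{p^m}$ denotes the subfield of $\overline{\mathbb{F}}$ with $p^m$ elements, so $\mathbb{F}_{p^m}((t^{\mathbb{Q}}))\subseteq\overline{\mathbb{F}}((t^{\mathbb{Q}}))$. *)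

theory Defs
  imports
    "HOL-Library.Nat_Bijection"
    "HOL-Algebra.Algebraic_Closure_Type"
    "Berlekamp_Zassenhaus.Finite_Field"
begin

section \<open>The Hahn field with exponents in the rationals\<close>

abbreviation supp :: "(rat \<Rightarrow> 'a::zero) \<Rightarrow> rat set" where
  "supp f \<equiv> {q. f q \<noteq> 0}"

text \<open>The order on the rationals is total, so a set of rationals is well-ordered iff \<open><\<close> is
  well-founded on it.\<close>

abbreviation wo :: "rat set \<Rightarrow> bool" where
  "wo A \<equiv> wfp_on A (<)"

lemma wo_iff_least: "wo A \<longleftrightarrow> (\<forall>B\<subseteq>A. B \<noteq> {} \<longrightarrow> (\<exists>z\<in>B. \<forall>y\<in>B. z \<le> y))"
  unfolding wfp_on_iff_ex_minimal by (meson linorder_not_le)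

lemma wo_least:
  assumes "wo A" "B \<subseteq> A" "B \<noteq> {}"
  obtains z where "z \<in> B" "\<And>y. y \<in> B \<Longrightarrow> z \<le> y"
  using assms wo_iff_least by metis

lemma wo_subset: "wo A \<Longrightarrow> B \<subseteq> A \<Longrightarrow> wo B"
  by (rule wfp_on_subset)

lemma wo_singleton: "wo {q}"
  unfolding wfp_on_def by blast

lemma wo_Un:
  assumes "wo A" "wo B"
  shows "wo (A \<union> B)"
  unfolding wo_iff_least
proof (intro allI impI)
  fix C assume C: "C \<subseteq> A \<union> B" "C \<noteq> {}"
  show "\<exists>z\<in>C. \<forall>y\<in>C. z \<le> y"
  proof (cases "C \<inter> A = {} \<or> C \<inter> B = {}")
    case True
    then have "C \<subseteq> A \<or> C \<subseteq> B" using C by blast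
    then show ?thesis using assms C wo_iff_least by metis
  next
    case False
    obtain z1 where z1: "z1 \<in> C \<inter> A" "\<And>y. y \<in> C \<inter> A \<Longrightarrow> z1 \<le> y"
      using wo_least[OF assms(1), of "C \<inter> A"] False by blast
    obtain z2 where z2: "z2 \<in> C \<inter> B" "\<And>y. y \<in> C \<inter> B \<Longrightarrow> z2 \<le> y"
      using wo_least[OF assms(2), of "C \<inter> B"] False by blast
    have "min z1 z2 \<in> C" using z1 z2 by (auto simp: min_def)
    moreover have "\<forall>y\<in>C. min z1 z2 \<le> y"
    proof
      fix y assume "y \<in> C"
      then have "y \<in> C \<inter> A \<or> y \<in> C \<inter> B" using C by blast
      then show "min z1 z2 \<le> y" using z1(2)[of y] z2(2)[of y] by (auto simp: min_def)
    qed
    ultimately show ?thesis by blast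
  qed
qed

lemma finite_wo_both:
  fixes S :: "rat set"
  assumes "wo S" and g: "\<And>B. B \<subseteq> S \<Longrightarrow> B \<noteq> {} \<Longrightarrow> \<exists>z\<in>B. \<forall>y\<in>B. y \<le> z"
  shows "finite S"
proof (rule ccontr)
  assume inf: "infinite S"
  define T where "T = {x\<in>S. finite {y\<in>S. y < x}}"
  have "S \<noteq> {}" using inf by auto
  then obtain z where z: "z \<in> S" "\<And>y. y \<in> S \<Longrightarrow> z \<le> y"
    using wo_least[OF assms(1), of S] by blast
  then have "{y\<in>S. y < z} = {}" by force
  then have "finite {y\<in>S. y < z}" by (simp only: finite.emptyI)
  then have "z \<in> T" unfolding T_def using z(1) by blast
  moreover have "T \<subseteq> S" by (auto simp: T_def)
  ultimately obtain m where m: "m \<in> T" "\<And>y. y \<in> T \<Longrightarrow> y \<le> m"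
    using g[of T] by blast
  have le: "{y\<in>S. y \<le> m} = insert m {y\<in>S. y < m}"
    using m(1) by (auto simp: T_def)
  have fin: "finite {y\<in>S. y \<le> m}"
    unfolding le using m(1) by (simp add: T_def)
  have "\<exists>y\<in>S. \<not> y \<le> m"
  proof (rule ccontr)
    assume "\<not> ?thesis"
    then have "S \<subseteq> {y\<in>S. y \<le> m}" by blast
    then show False using fin inf finite_subset by blast
  qed
  then have "{y\<in>S. y > m} \<noteq> {}" by (auto simp: not_le)
  then obtain k where k: "k \<in> {y\<in>S. y > m}" "\<And>y. y \<in> {y\<in>S. y > m} \<Longrightarrow> k \<le> y"
    using wo_least[OF assms(1), of "{y\<in>S. y > m}"] by blast
  have "{y\<in>S. y < k} \<subseteq> {y\<in>S. y \<le> m}" using k(2) by force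
  then have "k \<in> T" unfolding T_def using k(1) fin finite_subset by blast
  then show False using m(2)[of k] k(1) by auto
qed

definition pairs :: "rat set \<Rightarrow> rat set \<Rightarrow> rat \<Rightarrow> (rat \<times> rat) set" where
  "pairs A B q = {(a, b). a \<in> A \<and> b \<in> B \<and> a + b = q}"

definition sums_of :: "rat set \<Rightarrow> rat set \<Rightarrow> rat set" where
  "sums_of A B = {a + b | a b. a \<in> A \<and> b \<in> B}"

lemma finite_pairs:
  assumes "wo A" "wo B"
  shows "finite (pairs A B q)"
proof -
  define S where "S = {a\<in>A. q - a \<in> B}"
  have "finite S"
  proof (rule finite_wo_both)
    show "wo S" using assms(1) by (rule wo_subset) (auto simp: S_def)
    fix C assume C: "C \<subseteq> S" "C \<noteq> {}"
    then have "(\<lambda>a. q - a) ` C \<subseteq> B" "(\<lambda>a. q - a) ` C \<noteq> {}" by (auto simp: S_def)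
    then obtain z where z: "z \<in> (\<lambda>a. q - a) ` C" "\<And>y. y \<in> (\<lambda>a. q - a) ` C \<Longrightarrow> z \<le> y"
      using wo_least[OF assms(2)] by metis
    then obtain c where c: "c \<in> C" "z = q - c" by blast
    have "\<forall>y\<in>C. y \<le> c" using z(2) c(2) by fastforce
    then show "\<exists>z\<in>C. \<forall>y\<in>C. y \<le> z" using c by blast
  qed
  moreover have "pairs A B q \<subseteq> (\<lambda>a. (a, q - a)) ` S"
    by (auto simp: pairs_def S_def)
  ultimately show ?thesis by (meson finite_imageI finite_subset)
qed

lemma wo_sums_of:
  assumes A: "wo A" and B: "wo B"
  shows "wo (sums_of A B)"
  unfolding wo_iff_least
proof (intro allI impI)
  fix C assume C: "C \<subseteq> sums_of A B" "C \<noteq> {}"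
  define D where "D = {a\<in>A. \<exists>b\<in>B. a + b \<in> C}"
  have ex: "\<exists>b. (b \<in> B \<and> a + b \<in> C) \<and> (\<forall>y. y \<in> B \<and> a + y \<in> C \<longrightarrow> b \<le> y)" if "a \<in> D" for a
  proof -
    have "{b\<in>B. a + b \<in> C} \<noteq> {}" using that unfolding D_def by blast
    then obtain z where "z \<in> {b\<in>B. a + b \<in> C}" "\<And>y. y \<in> {b\<in>B. a + b \<in> C} \<Longrightarrow> z \<le> y"
      using wo_least[OF B, of "{b\<in>B. a + b \<in> C}"] by blast
    then show ?thesis by blast
  qed
  then obtain \<beta> where \<beta>: "\<And>a. a \<in> D \<Longrightarrow> \<beta> a \<in> B \<and> a + \<beta> a \<in> C"
      "\<And>a y. a \<in> D \<Longrightarrow> y \<in> B \<Longrightarrow> a + y \<in> C \<Longrightarrow> \<beta> a \<le> y"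
    by metis
  have DA: "D \<subseteq> A" by (auto simp: D_def)
  have Dne: "D \<noteq> {}" using C unfolding sums_of_def D_def by blast
  have step: "\<exists>a\<in>E. \<forall>x\<in>E. a + \<beta> a \<le> x + \<beta> x"
    if E: "E \<subseteq> D" "E \<noteq> {}" and
       IH: "\<And>c. c \<in> E \<Longrightarrow> {x\<in>E. x < c} \<noteq> {} \<Longrightarrow>
         \<exists>a\<in>{x\<in>E. x < c}. \<forall>x\<in>{x\<in>E. x < c}. a + \<beta> a \<le> x + \<beta> x" for E
  proof -
    have "\<beta> ` E \<subseteq> B" using \<beta>(1) E by auto
    then obtain z where z: "z \<in> \<beta> ` E" "\<And>y. y \<in> \<beta> ` E \<Longrightarrow> z \<le> y"
      using wo_least[OF B, of "\<beta> ` E"] E by blast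
    then obtain c where c: "c \<in> E" "z = \<beta> c" by blast
    have ge: "c + \<beta> c \<le> x + \<beta> x" if "x \<in> E" "\<not> x < c" for x
      using z(2)[of "\<beta> x"] that c by (auto intro!: add_mono)
    show ?thesis
    proof (cases "{x\<in>E. x < c} = {}")
      case True
      then show ?thesis using ge c by blast
    next
      case False
      obtain a where a: "a \<in> E" "\<And>x. x \<in> E \<Longrightarrow> x < c \<Longrightarrow> a + \<beta> a \<le> x + \<beta> x"
        using IH[OF c(1) False] by auto
      show ?thesis
      proof (cases "a + \<beta> a \<le> c + \<beta> c")
        case True
        have "a + \<beta> a \<le> x + \<beta> x" if "x \<in> E" for x
          using a(2)[OF that] ge[OF that] True by (cases "x < c") auto
        then show ?thesis using a by blast
      next
        case f: False
        have "c + \<beta> c \<le> x + \<beta> x" if "x \<in> E" for x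
          using a(2)[OF that] ge[OF that] f by (cases "x < c") auto
        then show ?thesis using c by blast
      qed
    qed
  qed
  have below: "\<exists>a\<in>{x\<in>D. x < c}. \<forall>x\<in>{x\<in>D. x < c}. a + \<beta> a \<le> x + \<beta> x"
    if "c \<in> A" "{x\<in>D. x < c} \<noteq> {}" for c
    using that(2)
  proof (induction rule: wfp_on_induct[OF A that(1)])
    case less: (1 c)
    show ?case
    proof (rule step)
      fix d assume d: "d \<in> {x\<in>D. x < c}" and ne: "{x\<in>{x\<in>D. x < c}. x < d} \<noteq> {}"
      have eq: "{x\<in>{x\<in>D. x < c}. x < d} = {x\<in>D. x < d}" using d by auto
      show "\<exists>a\<in>{x\<in>{x\<in>D. x < c}. x < d}. \<forall>x\<in>{x\<in>{x\<in>D. x < c}. x < d}. a + \<beta> a \<le> x + \<beta> x"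
        using less(2)[of d] d DA ne unfolding eq by blast
    qed (use less in auto)
  qed
  obtain a where a: "a \<in> D" "\<And>x. x \<in> D \<Longrightarrow> a + \<beta> a \<le> x + \<beta> x"
    using step[of D] below DA Dne by blast
  have "\<forall>y\<in>C. a + \<beta> a \<le> y"
  proof
    fix y assume y: "y \<in> C"
    then obtain x b where xb: "x \<in> A" "b \<in> B" "y = x + b" using C unfolding sums_of_def by blast
    then have "x \<in> D" using y unfolding D_def by blast
    then have "a + \<beta> a \<le> x + \<beta> x" "\<beta> x \<le> b" using a \<beta>(2) xb y by auto
    then show "a + \<beta> a \<le> y" using xb by simp
  qed
  then show "\<exists>z\<in>C. \<forall>y\<in>C. z \<le> y" using a(1) \<beta>(1) by blast
qed

text \<open>The sum below has only finitely many terms when both supports are well-ordered, by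
  \<open>finite_pairs\<close>.\<close>

definition conv :: "(rat \<Rightarrow> 'a::comm_ring_1) \<Rightarrow> (rat \<Rightarrow> 'a) \<Rightarrow> rat \<Rightarrow> 'a" where
  "conv f g q = (\<Sum>(a, b)\<in>{(a, b). f a \<noteq> 0 \<and> g b \<noteq> 0 \<and> a + b = q}. f a * g b)"

lemma conv_superset:
  assumes "wo A" "wo B" "supp f \<subseteq> A" "supp g \<subseteq> B"
  shows "conv f g q = (\<Sum>(a, b)\<in>pairs A B q. f a * g b)"
  unfolding conv_def
proof (rule sum.mono_neutral_left)
  show "finite (pairs A B q)" using assms finite_pairs by blast
  show "{(a, b). f a \<noteq> 0 \<and> g b \<noteq> 0 \<and> a + b = q} \<subseteq> pairs A B q"
    using assms(3,4) unfolding pairs_def by blast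
  show "\<forall>i\<in>pairs A B q - {(a, b). f a \<noteq> 0 \<and> g b \<noteq> 0 \<and> a + b = q}. (case i of (a, b) \<Rightarrow> f a * g b) = 0"
    unfolding pairs_def by auto
qed

lemma supp_conv: "supp (conv f g) \<subseteq> sums_of (supp f) (supp g)"
proof
  fix q assume "q \<in> supp (conv f g)"
  then have "conv f g q \<noteq> 0" by simp
  then have "{(a, b). f a \<noteq> 0 \<and> g b \<noteq> 0 \<and> a + b = q} \<noteq> {}"
    unfolding conv_def using sum.empty by metis
  then show "q \<in> sums_of (supp f) (supp g)" unfolding sums_of_def by blast
qed

lemma wo_supp_conv: "wo (supp f) \<Longrightarrow> wo (supp g) \<Longrightarrow> wo (supp (conv f g))"
  by (rule wo_subset[OF wo_sums_of supp_conv])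

lemma conv_commute: "conv f g q = conv g f q"
  unfolding conv_def
  by (rule sum.reindex_bij_witness[of _ "\<lambda>(a, b). (b, a)" "\<lambda>(a, b). (b, a)"])
     (auto simp: mult.commute add.commute)

lemma conv_assoc_aux:
  assumes f: "wo (supp f)" and g: "wo (supp g)" and h: "wo (supp h)"
  shows "conv (conv f g) h q =
    (\<Sum>(a, b, c)\<in>{(a, b, c). f a \<noteq> 0 \<and> g b \<noteq> 0 \<and> h c \<noteq> 0 \<and> a + b + c = q}. f a * g b * h c)"
    (is "_ = sum _ ?T")
proof -
  let ?S = "sums_of (supp f) (supp g)"
  have S: "wo ?S" using f g wo_sums_of by blast
  have "conv (conv f g) h q = (\<Sum>(s, c)\<in>pairs ?S (supp h) q. conv f g s * h c)"
    by (rule conv_superset[OF S h supp_conv]) simp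
  also have "\<dots> = (\<Sum>sc\<in>pairs ?S (supp h) q. \<Sum>ab\<in>pairs (supp f) (supp g) (fst sc).
      f (fst ab) * g (snd ab) * h (snd sc))"
    by (simp only: conv_superset[OF f g subset_refl subset_refl] sum_distrib_right case_prod_unfold)
  also have "\<dots> = (\<Sum>(sc, ab)\<in>Sigma (pairs ?S (supp h) q) (\<lambda>sc. pairs (supp f) (supp g) (fst sc)).
      f (fst ab) * g (snd ab) * h (snd sc))"
    by (rule sum.Sigma) (use finite_pairs S f g h in auto)
  also have "\<dots> = (\<Sum>v\<in>?T. f (fst v) * g (fst (snd v)) * h (snd (snd v)))"
  proof (rule sum.reindex_bij_witness[of _ "\<lambda>v. ((fst v + fst (snd v), snd (snd v)), (fst v, fst (snd v)))"
          "\<lambda>u. (fst (snd u), snd (snd u), snd (fst u))"])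
    fix u assume "u \<in> Sigma (pairs ?S (supp h) q) (\<lambda>sc. pairs (supp f) (supp g) (fst sc))"
    then obtain s c a b where u: "u = ((s, c), (a, b))" "h c \<noteq> 0" "s + c = q"
        "f a \<noteq> 0" "g b \<noteq> 0" "a + b = s"
      unfolding pairs_def by fastforce
    let ?v = "(fst (snd u), snd (snd u), snd (fst u))"
    show "((fst ?v + fst (snd ?v), snd (snd ?v)), (fst ?v, fst (snd ?v))) = u"
      using u by simp
    show "?v \<in> ?T"
      using u by simp
    show "f (fst ?v) * g (fst (snd ?v)) * h (snd (snd ?v)) =
        (case u of (sc, ab) \<Rightarrow> f (fst ab) * g (snd ab) * h (snd sc))"
      using u by simp
  next
    fix v assume "v \<in> ?T"
    then obtain a b c where v: "v = (a, b, c)" "f a \<noteq> 0" "g b \<noteq> 0" "h c \<noteq> 0" "a + b + c = q"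
      by blast
    then have "a + b \<in> ?S" unfolding sums_of_def by blast
    then have "(a + b, c) \<in> pairs ?S (supp h) q" "(a, b) \<in> pairs (supp f) (supp g) (a + b)"
      using v unfolding pairs_def by simp_all
    then show "((fst v + fst (snd v), snd (snd v)), (fst v, fst (snd v)))
        \<in> Sigma (pairs ?S (supp h) q) (\<lambda>sc. pairs (supp f) (supp g) (fst sc))"
      using v by simp
    let ?u = "((fst v + fst (snd v), snd (snd v)), (fst v, fst (snd v)))"
    show "(fst (snd ?u), snd (snd ?u), snd (fst ?u)) = v"
      using v by simp
  qed
  also have "\<dots> = (\<Sum>(a, b, c)\<in>?T. f a * g b * h c)"
    by (simp only: case_prod_unfold)
  finally show ?thesis .
qed

lemma conv_assoc:
  assumes f: "wo (supp f)" and g: "wo (supp g)" and h: "wo (supp h)"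
  shows "conv (conv f g) h q = conv f (conv g h) q"
proof -
  have "conv f (conv g h) q = conv (conv g h) f q" by (rule conv_commute)
  also have "\<dots> = conv (conv f g) h q"
    unfolding conv_assoc_aux[OF g h f] conv_assoc_aux[OF f g h]
    by (rule sum.reindex_bij_witness[of _ "\<lambda>(a, b, c). (b, c, a)" "\<lambda>(b, c, a). (a, b, c)"])
       (auto simp: mult_ac add_ac)
  finally show ?thesis ..
qed

lemma supp_add: "supp (\<lambda>q. f q + g q :: 'a::comm_ring_1) \<subseteq> supp f \<union> supp g"
  by auto

lemma conv_add:
  assumes f: "wo (supp f)" and g: "wo (supp g)" and h: "wo (supp h)"
  shows "conv (\<lambda>q. f q + g q) h q = conv f h q + conv g h q"
proof -
  let ?A = "supp f \<union> supp g"
  have A: "wo ?A" using f g wo_Un by blast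
  have "conv (\<lambda>q. f q + g q) h q = (\<Sum>(a, b)\<in>pairs ?A (supp h) q. (f a + g a) * h b)"
    by (rule conv_superset[OF A h supp_add subset_refl])
  also have "\<dots> = (\<Sum>(a, b)\<in>pairs ?A (supp h) q. f a * h b) +
      (\<Sum>(a, b)\<in>pairs ?A (supp h) q. g a * h b)"
    by (simp only: sum.distrib[symmetric] case_prod_unfold distrib_right)
  also have "\<dots> = conv f h q + conv g h q"
    by (simp only: conv_superset[OF A h Un_upper1 subset_refl] conv_superset[OF A h Un_upper2 subset_refl])
  finally show ?thesis .
qed

lemma conv_monom: "conv (\<lambda>q. if q = r then c else 0) g q = c * g (q - r)"
proof -
  let ?S = "{(a, b). (if a = r then c else 0) \<noteq> 0 \<and> g b \<noteq> 0 \<and> a + b = q}"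
  have S: "a = r \<and> b = q - r \<and> c \<noteq> 0 \<and> g b \<noteq> 0" if "(a, b) \<in> ?S" for a b
  proof -
    have n: "(if a = r then c else 0) \<noteq> 0" and g: "g b \<noteq> 0" and ab: "a + b = q"
      using that by simp_all
    have a: "a = r" by (rule ccontr) (use n in simp)
    moreover have "c \<noteq> 0" using n unfolding a by simp
    moreover have "b = q - r" using ab unfolding a by (simp add: eq_diff_eq add.commute)
    ultimately show ?thesis using g by blast
  qed
  show ?thesis
  proof (cases "c = 0 \<or> g (q - r) = 0")
    case True
    have nin: "ab \<notin> ?S" for ab
    proof (cases ab)
      case (Pair a b)
      show ?thesis
      proof
        assume "ab \<in> ?S"
        from S[OF this[unfolded Pair]] show False using True by metis
      qed
    qed
    have "?S = {}" by (rule equals0I) (erule notE[OF nin])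
    then have "conv (\<lambda>q. if q = r then c else 0) g q = 0"
      unfolding conv_def by (simp only: sum.empty)
    moreover have "c * g (q - r) = 0" using True by (elim disjE) simp_all
    ultimately show ?thesis by (simp only:)
  next
    case False
    have mem: "(r, q - r) \<in> ?S" using False by simp
    have uniq: "ab = (r, q - r)" if ab: "ab \<in> ?S" for ab
    proof (cases ab)
      case (Pair a b)
      from S[OF ab[unfolded Pair]] show ?thesis using Pair by simp
    qed
    have "?S = {(r, q - r)}"
    proof (rule equalityI)
      show "?S \<subseteq> {(r, q - r)}" by (rule subsetI) (simp only: singleton_iff, erule uniq)
      show "{(r, q - r)} \<subseteq> ?S" using mem by (simp only: insert_subset empty_subsetI)
    qed
    then have "conv (\<lambda>q. if q = r then c else 0) g q =
        (\<Sum>(a, b)\<in>{(r, q - r)}. (if a = r then c else 0) * g b)"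
      unfolding conv_def by (simp only:)
    then show ?thesis by simp
  qed
qed

lemma wo_empty: "wo {}"
  unfolding wfp_on_def by blast

text \<open>\<open>hcoeff x q\<close> is the coefficient of \<open>t\<^sup>q\<close>, and \<open>hmonom c r\<close> below is \<open>c t\<^sup>r\<close>.\<close>

typedef (overloaded) 'a hahn = "{f :: rat \<Rightarrow> 'a::zero. wo (supp f)}"
  morphisms hcoeff Abs_hahn
proof
  show "(\<lambda>_. 0) \<in> {f :: rat \<Rightarrow> 'a. wo (supp f)}" by (simp add: wfp_on_def)
qed

setup_lifting type_definition_hahn

lemma hahn_eqI: "(\<And>q. hcoeff x q = hcoeff y q) \<Longrightarrow> x = y"
  by (simp add: hcoeff_inject[symmetric] fun_eq_iff)

lemma wo_supp_hcoeff: "wo (supp (hcoeff x))"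
  using hcoeff[of x] by simp

lift_definition hmonom :: "'a::zero \<Rightarrow> rat \<Rightarrow> 'a hahn" is "\<lambda>c r q. if q = r then c else 0"
  by (rule wo_subset[OF wo_singleton]) auto

instantiation hahn :: (comm_ring_1) comm_ring_1
begin

lift_definition zero_hahn :: "'a hahn" is "\<lambda>_. 0"
  by (simp add: wfp_on_def)

definition one_hahn :: "'a hahn" where
  "one_hahn = hmonom 1 0"

lift_definition plus_hahn :: "'a hahn \<Rightarrow> 'a hahn \<Rightarrow> 'a hahn" is "\<lambda>f g q. f q + g q"
  by (rule wo_subset[OF wo_Un supp_add])

lift_definition uminus_hahn :: "'a hahn \<Rightarrow> 'a hahn" is "\<lambda>f q. - f q"
  by simp

definition minus_hahn :: "'a hahn \<Rightarrow> 'a hahn \<Rightarrow> 'a hahn" where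
  "minus_hahn x y = x + - y"

lift_definition times_hahn :: "'a hahn \<Rightarrow> 'a hahn \<Rightarrow> 'a hahn" is conv
  by (rule wo_supp_conv)

instance
proof
  fix x y z :: "'a hahn"
  have conv_eq: "hcoeff (u * v) = conv (hcoeff u) (hcoeff v)" for u v :: "'a hahn"
    by (rule times_hahn.rep_eq)
  show "x + y + z = x + (y + z)"
    by (rule hahn_eqI) (simp add: plus_hahn.rep_eq add.assoc)
  show "x + y = y + x"
    by (rule hahn_eqI) (simp add: plus_hahn.rep_eq add.commute)
  show "0 + x = x"
    by (rule hahn_eqI) (simp add: plus_hahn.rep_eq zero_hahn.rep_eq)
  show "- x + x = 0"
    by (rule hahn_eqI) (simp add: plus_hahn.rep_eq zero_hahn.rep_eq uminus_hahn.rep_eq)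
  show "x - y = x + - y"
    by (rule minus_hahn_def)
  show "x * y * z = x * (y * z)"
    unfolding hcoeff_inject[symmetric] conv_eq
    by (rule ext) (rule conv_assoc[OF wo_supp_hcoeff wo_supp_hcoeff wo_supp_hcoeff])
  show "x * y = y * x"
    unfolding hcoeff_inject[symmetric] conv_eq by (rule ext) (rule conv_commute)
  show "1 * x = x"
    by (rule hahn_eqI) (simp only: conv_eq one_hahn_def hmonom.rep_eq conv_monom mult_1_left diff_0_right)
  show "(x + y) * z = x * z + y * z"
    by (rule hahn_eqI)
       (simp only: conv_eq plus_hahn.rep_eq conv_add[OF wo_supp_hcoeff wo_supp_hcoeff wo_supp_hcoeff])
  have "hcoeff (0::'a hahn) 0 \<noteq> hcoeff 1 0"
    by (simp add: zero_hahn.rep_eq one_hahn_def hmonom.rep_eq)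
  then show "(0::'a hahn) \<noteq> 1" by metis
qed

end

lemma hcoeff_zero [simp]: "hcoeff 0 q = 0"
  by (simp add: zero_hahn.rep_eq)

lemma hcoeff_hmonom: "hcoeff (hmonom c r) q = (if q = r then c else 0)"
  by (simp add: hmonom.rep_eq)

lemma hcoeff_one: "hcoeff 1 q = (if q = 0 then 1 else 0)"
  by (simp add: one_hahn_def hcoeff_hmonom)

lemma hcoeff_add [simp]: "hcoeff (x + y) q = hcoeff x q + hcoeff y q"
  by (simp add: plus_hahn.rep_eq)

lemma hcoeff_uminus [simp]: "hcoeff (- x) q = - hcoeff x q"
  by (simp add: uminus_hahn.rep_eq)

lemma hcoeff_diff [simp]: "hcoeff (x - y) q = hcoeff x q - hcoeff y q"
  unfolding minus_hahn_def hcoeff_add hcoeff_uminus by (rule add_uminus_conv_diff)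

lemma hcoeff_sum: "hcoeff (sum f A) q = (\<Sum>i\<in>A. hcoeff (f i) q)"
  by (induction A rule: infinite_finite_induct) auto

lemma hcoeff_mult: "hcoeff (x * y) q = conv (hcoeff x) (hcoeff y) q"
  by (simp add: times_hahn.rep_eq)

lemma hcoeff_hmonom_mult: "hcoeff (hmonom c r * x) q = c * hcoeff x (q - r)"
  by (simp only: hcoeff_mult hmonom.rep_eq conv_monom)

lemma hmonom_mult: "hmonom c r * hmonom d s = hmonom (c * d) (r + s)"
proof (rule hahn_eqI)
  fix q
  have "q - r = s \<longleftrightarrow> q = r + s" by linarith
  then show "hcoeff (hmonom c r * hmonom d s) q = hcoeff (hmonom (c * d) (r + s)) q"
    by (cases "q = r + s") (simp_all add: hcoeff_hmonom_mult hcoeff_hmonom)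
qed

lemma hmonom_power: "hmonom c r ^ n = hmonom (c ^ n) (of_nat n * r)"
  by (induction n) (simp_all add: hmonom_mult one_hahn_def distrib_right)

lemma hmonom_add: "hmonom (c + d) r = hmonom c r + (hmonom d r :: 'a::comm_ring_1 hahn)"
  by (rule hahn_eqI) (simp add: hcoeff_hmonom)

lemma hmonom_zero [simp]: "hmonom 0 r = (0 :: 'a::comm_ring_1 hahn)"
  by (rule hahn_eqI) (simp add: hcoeff_hmonom)

definition hge :: "'a::comm_ring_1 hahn \<Rightarrow> rat \<Rightarrow> bool" where
  "hge x r \<longleftrightarrow> (\<forall>q<r. hcoeff x q = 0)"

lemma hge_mult: "hge x r \<Longrightarrow> hge y s \<Longrightarrow> hge (x * y) (r + s)"
  unfolding hge_def
proof (intro allI impI)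
  fix q assume x: "\<forall>q<r. hcoeff x q = 0" and y: "\<forall>q<s. hcoeff y q = 0" and q: "q < r + s"
  have "{(a, b). hcoeff x a \<noteq> 0 \<and> hcoeff y b \<noteq> 0 \<and> a + b = q} = {}"
  proof -
    { fix a b assume "hcoeff x a \<noteq> 0" "hcoeff y b \<noteq> 0" "a + b = q"
      then have "r \<le> a" "s \<le> b" using x y by (meson not_less)+
      then have False using \<open>a + b = q\<close> q by linarith }
    then show ?thesis by blast
  qed
  then show "hcoeff (x * y) q = 0" unfolding hcoeff_mult conv_def by (simp only: sum.empty)
qed

lemma hge_power: "hge x r \<Longrightarrow> hge (x ^ n) (of_nat n * r)"
proof (induction n)
  case 0
  show ?case by (auto simp: hge_def hcoeff_one)
next
  case (Suc n)
  then have "hge (x * x ^ n) (r + of_nat n * r)" by (intro hge_mult)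
  then show ?case by (simp add: algebra_simps)
qed

lemma hcoeff_mult_cong:
  assumes w: "hge w 0" and eq: "\<And>b. b \<le> q \<Longrightarrow> hcoeff y b = hcoeff z b"
  shows "hcoeff (w * y) q = hcoeff (w * z) q"
proof -
  let ?B = "supp (hcoeff y) \<union> supp (hcoeff z)"
  have B: "wo ?B" by (intro wo_Un wo_supp_hcoeff)
  have "hcoeff w a * hcoeff y b = hcoeff w a * hcoeff z b"
    if "(a, b) \<in> pairs (supp (hcoeff w)) ?B q" for a b
  proof -
    have "0 \<le> a" "a + b = q" using that w by (auto simp: pairs_def hge_def not_less[symmetric])
    then show ?thesis using eq[of b] by simp
  qed
  then show ?thesis unfolding hcoeff_mult
    by (subst (1 2) conv_superset[OF wo_supp_hcoeff B]) (auto intro!: sum.cong)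
qed

lemma hahn_one_minus_inverse:
  fixes u :: "'a::comm_ring_1 hahn"
  assumes s: "s > 0" and u: "hge u s"
  shows "\<exists>y. (1 - u) * y = 1"
proof -
  define N where "N q = nat \<lceil>q / s\<rceil>" for q
  have big: "q < of_nat n * s" if "n > N q" for n q
  proof -
    have "q / s \<le> of_int \<lceil>q / s\<rceil>" by (rule le_of_int_ceiling)
    also have "\<dots> \<le> of_nat (N q)" unfolding N_def by linarith
    also have "\<dots> < of_nat n" using that by simp
    finally show ?thesis using s by (simp add: field_simps)
  qed
  define Y where "Y M = (\<Sum>n\<le>M. u ^ n)" for M
  define f where "f q = hcoeff (Y (N q)) q" for q
  have stab: "hcoeff (Y M) q = f q" if "M \<ge> N q" for M q
  proof -
    have "(\<Sum>n\<le>M. hcoeff (u ^ n) q) = (\<Sum>n\<le>N q. hcoeff (u ^ n) q)"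
    proof (rule sum.mono_neutral_right)
      show "\<forall>i\<in>{..M} - {..N q}. hcoeff (u ^ i) q = 0"
      proof
        fix i assume "i \<in> {..M} - {..N q}"
        then have "q < of_nat i * s" by (intro big) simp
        then show "hcoeff (u ^ i) q = 0" using hge_power[OF u, of i] unfolding hge_def by blast
      qed
    qed (use that in auto)
    then show ?thesis unfolding f_def Y_def hcoeff_sum .
  qed
  have mono: "N q' \<le> N q" if "q' \<le> q" for q' q
    unfolding N_def using that s by (intro nat_mono ceiling_mono divide_right_mono) auto
  have wof: "wo (supp f)"
    unfolding wo_iff_least
  proof (intro allI impI)
    fix B assume B: "B \<subseteq> supp f" "B \<noteq> {}"
    then obtain q where q: "q \<in> B" by blast
    have sub: "{b\<in>B. b \<le> q} \<subseteq> supp (hcoeff (Y (N q)))"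
    proof
      fix b assume b: "b \<in> {b\<in>B. b \<le> q}"
      then have "hcoeff (Y (N q)) b = f b" using stab[OF mono] by simp
      moreover have "f b \<noteq> 0" using b B(1) by blast
      ultimately show "b \<in> supp (hcoeff (Y (N q)))" by simp
    qed
    have ne: "{b\<in>B. b \<le> q} \<noteq> {}" using q by blast
    obtain z where z: "z \<in> {b\<in>B. b \<le> q}" "\<And>y. y \<in> {b\<in>B. b \<le> q} \<Longrightarrow> z \<le> y"
      using wo_least[OF wo_supp_hcoeff sub ne] by blast
    have "\<forall>y\<in>B. z \<le> y"
    proof
      fix y assume "y \<in> B"
      show "z \<le> y"
      proof (cases "y \<le> q")
        case True then show ?thesis using z \<open>y \<in> B\<close> by auto
      next
        case False then show ?thesis using z(1) by auto
      qed
    qed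
    then show "\<exists>z\<in>B. \<forall>y\<in>B. z \<le> y" using z(1) by blast
  qed
  define y where "y = Abs_hahn f"
  have y: "hcoeff y = f" unfolding y_def using wof by (simp add: Abs_hahn_inverse)
  have u0: "hge (1 - u) 0"
    using u s by (simp add: hge_def hcoeff_one)
  have "(1 - u) * y = 1"
  proof (rule hahn_eqI)
    fix q
    have "hcoeff ((1 - u) * y) q = hcoeff ((1 - u) * Y (N q)) q"
    proof (rule hcoeff_mult_cong[OF u0])
      fix b assume "b \<le> q"
      then show "hcoeff y b = hcoeff (Y (N q)) b" unfolding y using stab[OF mono] by simp
    qed
    also have "(1 - u) * Y (N q) = 1 - u ^ Suc (N q)"
      unfolding Y_def by (rule sum_gp_basic)
    also have "hcoeff (1 - u ^ Suc (N q)) q = hcoeff 1 q"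
    proof -
      have "hcoeff (u ^ Suc (N q)) q = 0"
        using hge_power[OF u, of "Suc (N q)"] big[of q "Suc (N q)"] unfolding hge_def by blast
      then show ?thesis by (simp only: hcoeff_diff diff_zero)
    qed
    finally show "hcoeff ((1 - u) * y) q = hcoeff 1 q" .
  qed
  then show ?thesis by blast
qed

lemma hahn_inverse_exists:
  fixes x :: "'a::{comm_ring_1, inverse} hahn"
  assumes "x \<noteq> 0" and inv: "\<And>c::'a. c \<noteq> 0 \<Longrightarrow> inverse c * c = 1"
  shows "\<exists>y. x * y = 1"
proof -
  have "supp (hcoeff x) \<noteq> {}"
    using \<open>x \<noteq> 0\<close> hahn_eqI[of x 0] by auto
  then obtain r where r: "r \<in> supp (hcoeff x)" "\<And>q. q \<in> supp (hcoeff x) \<Longrightarrow> r \<le> q"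
    using wo_least[OF wo_supp_hcoeff[of x], of "supp (hcoeff x)"] by blast
  define m where "m = hmonom (inverse (hcoeff x r)) (- r)"
  define u where "u = 1 - m * x"
  have u_pos: "hcoeff u q = 0" if "q \<le> 0" for q
  proof (cases "q = 0")
    case True
    then show ?thesis using r(1) inv
      by (simp add: u_def m_def hcoeff_hmonom_mult hcoeff_one)
  next
    case False
    then have "q + r < r" using that by simp
    then have "hcoeff x (q + r) = 0" using r(2)[of "q + r"] by force
    then show ?thesis using False
      by (simp add: u_def m_def hcoeff_hmonom_mult hcoeff_one)
  qed
  have "\<exists>s>0. hge u s"
  proof (cases "supp (hcoeff u) = {}")
    case True
    then have "hge u 1" unfolding hge_def by blast
    then show ?thesis by (intro exI[of _ 1]) simp
  next
    case False
    then obtain s where s: "s \<in> supp (hcoeff u)" "\<And>q. q \<in> supp (hcoeff u) \<Longrightarrow> s \<le> q"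
      using wo_least[OF wo_supp_hcoeff[of u], of "supp (hcoeff u)"] by blast
    have "s > 0" using u_pos[of s] s(1) by force
    moreover have "hge u s" unfolding hge_def using s(2) by force
    ultimately show ?thesis by blast
  qed
  then obtain y where "(1 - u) * y = 1" using hahn_one_minus_inverse by blast
  then have "x * (m * y) = 1" unfolding u_def by (simp add: mult_ac)
  then show ?thesis by blast
qed

instantiation hahn :: (field) field
begin

definition inverse_hahn :: "'a hahn \<Rightarrow> 'a hahn" where
  "inverse_hahn x = (if x = 0 then 0 else THE y. x * y = 1)"

definition divide_hahn :: "'a hahn \<Rightarrow> 'a hahn \<Rightarrow> 'a hahn" where
  "divide_hahn x y = x * inverse y"

instance
proof
  fix x y :: "'a hahn"
  show "inverse x * x = 1" if x: "x \<noteq> 0"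
  proof -
    obtain y where y: "x * y = 1" using hahn_inverse_exists[OF x] by auto
    have "(THE y. x * y = 1) = y"
    proof (rule the_equality[where a = y])
      fix z assume "x * z = 1"
      then have "z = (x * y) * z" using y by simp
      also have "\<dots> = y * (x * z)" by (simp add: mult_ac)
      finally show "z = y" using \<open>x * z = 1\<close> by simp
    qed (rule y)
    then show ?thesis using x y by (simp add: inverse_hahn_def mult.commute)
  qed
  show "x div y = x * inverse y" by (rule divide_hahn_def)
  show "inverse (0::'a hahn) = 0" by (simp add: inverse_hahn_def)
qed

end

text \<open>\<open>K((t\<^sup>Q))\<close> for a subset (in practice a subfield) \<open>K\<close> of the coefficients, as a
  subset of the big Hahn field.\<close>

definition hahn_over :: "'a::zero set \<Rightarrow> 'a hahn set" where
  "hahn_over S = {x. \<forall>q. hcoeff x q \<in> S}"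

section \<open>Finite subfields\<close>

text \<open>Only meaningful if there is exactly one such subfield. In an algebraically closed field of
  characteristic \<open>p\<close> this is so for \<open>n = p\<^sup>m\<close>, \<open>m > 0\<close>, by \<open>subfield_of_card_eq\<close> below.\<close>

definition subfield_of_card :: "nat \<Rightarrow> 'k::field set" where
  "subfield_of_card n = (THE S. subfield S ring_of_type_algebra \<and> card S = n)"

instance alg_closure :: (field_prime_char) field_prime_char
  by (rule field_prime_charI') (simp only: CHAR_alg_closure CHAR_pos)

lemma subfield_of_card_eq:
  assumes m: "m > 0" and q: "q = CHAR('k) ^ m"
  shows "subfield_of_card q = {x :: 'k::{field_prime_char, alg_closed_field}. x ^ q = x}" (is "_ = ?S")
    and "card {x :: 'k. x ^ q = x} = q"
    and "subfield {x :: 'k. x ^ q = x} ring_of_type_algebra"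
proof -
  let ?R = "ring_of_type_algebra :: 'k ring"
  have R: "carrier ?R = UNIV" "\<zero>\<^bsub>?R\<^esub> = 0" "\<one>\<^bsub>?R\<^esub> = 1"
      "\<And>x y. x \<otimes>\<^bsub>?R\<^esub> y = x * y" "\<And>x y. x \<oplus>\<^bsub>?R\<^esub> y = x + y"
    by (simp_all add: ring_of_type_algebra_def)
  interpret R: field ?R by (rule field_from_type_algebra)
  have pr: "prime CHAR('k)" by (rule prime_CHAR_semidom) simp
  have p1: "CHAR('k) > 1" using pr by (rule prime_gt_1_nat)
  have q1: "q > 1" unfolding q using one_less_power[OF p1 m] .
  have q0: "(of_nat q :: 'k) = 0" unfolding q using m by simp

  define P :: "'k poly" where "P = monom 1 q - monom 1 1"
  have poly_P: "poly P x = x ^ q - x" for x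
    by (simp add: P_def poly_monom)
  have deg: "degree P = q"
  proof -
    have "degree (monom (1::'k) q + - monom 1 1) = degree (monom (1::'k) q)"
      by (rule degree_add_eq_left) (use q1 in \<open>simp add: degree_monom_eq\<close>)
    then show ?thesis by (simp add: P_def degree_monom_eq)
  qed
  then have "P \<noteq> 0" using q1 by auto
  have dP: "pderiv P = - 1"
    unfolding P_def pderiv_diff pderiv_monom q0 by (simp add: one_pCons monom_0)
  obtain A l where A: "size A = degree P" "P = smult l (\<Prod>x\<in>#A. [:- x, 1:])"
    using alg_closed_imp_factorization[OF \<open>P \<noteq> 0\<close>] by blast
  have "l \<noteq> 0" using A(2) \<open>P \<noteq> 0\<close> by (cases "l = 0") simp_all
  have dist: "count A x \<le> 1" for x
  proof (rule ccontr)
    assume "\<not> count A x \<le> 1"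
    then have "replicate_mset 2 x \<subseteq># A" by (simp add: count_le_replicate_mset_subset_eq[symmetric])
    then obtain B where "A = replicate_mset 2 x + B" using subset_mset.le_iff_add by blast
    then have "(\<Prod>x\<in>#A. [:- x, 1:]) = [:- x, 1:] * ([:- x, 1:] * (\<Prod>x\<in>#B. [:- x, 1:]))"
      by (simp only: numeral_2_eq_2 replicate_mset_Suc replicate_mset_0 image_mset_union image_mset_add_mset
          image_mset_empty prod_mset_Un prod_mset.add_mset prod_mset_empty mult_1_right mult.assoc)
    then have "P = [:- x, 1:] * ([:- x, 1:] * smult l (\<Prod>x\<in>#B. [:- x, 1:]))"
      unfolding A(2) by (simp only: mult_smult_right)
    then obtain C where "P = [:- x, 1:] * ([:- x, 1:] * C)" ..
    then have "pderiv P = [:- x, 1:] * pderiv ([:- x, 1:] * C) + [:- x, 1:] * C * pderiv [:- x, 1:]"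
      by (simp only: pderiv_mult)
    moreover have "poly [:- x, 1:] x = 0" by simp
    ultimately have "poly (pderiv P) x = 0" by (simp only: poly_add poly_mult mult_zero_left add_0)
    then show False unfolding dP by simp
  qed
  have roots: "?S = set_mset A"
  proof -
    have "x ^ q = x \<longleftrightarrow> poly P x = 0" for x by (simp add: poly_P)
    moreover have "poly P x = 0 \<longleftrightarrow> x \<in># A" for x
      unfolding A(2) using \<open>l \<noteq> 0\<close> by (auto simp: poly_prod_mset prod_mset_zero_iff)
    ultimately show ?thesis by blast
  qed
  have "card (set_mset A) = size A"
  proof -
    have "size A = (\<Sum>x\<in>set_mset A. count A x)" by (rule size_multiset_overloaded_eq)
    also have "\<dots> = (\<Sum>x\<in>set_mset A. 1)"
      by (rule sum.cong[OF refl]) (metis dist count_greater_eq_one_iff le_antisym)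
    finally show ?thesis by simp
  qed
  then show card: "card ?S = q" unfolding roots using A(1) deg by simp
  have fin: "finite ?S" unfolding roots by simp

  show sub: "subfield ?S ?R"
  proof (rule R.subfieldI')
    have neg: "- x \<in> ?S" if "x \<in> ?S" for x
    proof -
      have "(x + - x) ^ q = x ^ q + (- x) ^ q" by (rule freshmans_dream'[OF pr q])
      moreover have "(x + - x) ^ q = 0" unfolding right_minus using q1 by (simp add: power_0_left)
      moreover have "x ^ q = x" using that by simp
      ultimately have "x + (- x) ^ q = 0" by metis
      then show ?thesis by (simp add: eq_neg_iff_add_eq_0 add.commute)
    qed
    show "subring ?S ?R"
    proof (rule R.subringI)
      fix x assume x: "x \<in> ?S"
      have "\<ominus>\<^bsub>?R\<^esub> x = - x" by (rule R.minus_equality) (simp_all add: R)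
      then show "\<ominus>\<^bsub>?R\<^esub> x \<in> ?S" using neg[OF x] by (simp only:)
    next
      fix x y assume "x \<in> ?S" "y \<in> ?S"
      then show "x \<otimes>\<^bsub>?R\<^esub> y \<in> ?S" "x \<oplus>\<^bsub>?R\<^esub> y \<in> ?S"
        using freshmans_dream'[OF pr q, of x y] by (simp_all add: R power_mult_distrib)
    qed (simp_all add: R)
    fix x assume x: "x \<in> ?S - {\<zero>\<^bsub>?R\<^esub>}"
    have "inv\<^bsub>?R\<^esub> x = inverse x" by (rule R.inv_char) (use x in \<open>simp_all add: R\<close>)
    then show "inv\<^bsub>?R\<^esub> x \<in> ?S" using x by (simp add: power_inverse)
  qed

  have uniq: "T = ?S" if T: "subfield T ?R" "card T = q" for T
  proof -
    note E = subringE[OF subfieldE(1)[OF T(1)], unfolded R]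
    have finT: "finite T" using T(2) q1 by (intro card_ge_0_finite) simp
    have "x ^ q = x" if x: "x \<in> T" for x
    proof (cases "x = 0")
      case True then show ?thesis using q1 by simp
    next
      case False
      let ?U = "T - {0}"
      have cU: "card ?U = q - 1" using T(2) E(2) by simp
      have inj: "inj_on ((*) x) ?U" using False by (auto simp: inj_on_def)
      have "(*) x ` ?U \<subseteq> ?U" using E(6)[OF x] False by auto
      then have im: "(*) x ` ?U = ?U"
        by (intro card_subset_eq) (use finT card_image[OF inj] in auto)
      have "\<Prod>?U = (\<Prod>y\<in>?U. x * y)"
        using prod.reindex[OF inj, of "\<lambda>y. y"] unfolding im by (simp add: o_def)
      also have "\<dots> = x ^ (q - 1) * \<Prod>?U" by (simp add: prod.distrib cU)
      finally have "1 * \<Prod>?U = x ^ (q - 1) * \<Prod>?U" unfolding mult_1_left .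
      moreover have "\<Prod>?U \<noteq> 0" using finT by (simp add: prod_zero_iff)
      ultimately have "x ^ (q - 1) = 1" by (metis mult_right_cancel)
      moreover have "x ^ q = x * x ^ (q - 1)" using q1 by (simp add: power_eq_if)
      ultimately show ?thesis by simp
    qed
    then have "T \<subseteq> ?S" by blast
    then show ?thesis by (rule card_subset_eq[OF fin]) (simp only: T(2) card)
  qed
  show "subfield_of_card q = ?S"
    unfolding subfield_of_card_def
  proof (rule the_equality)
    show "subfield ?S ?R \<and> card ?S = q" by (rule conjI[OF sub card])
    show "T = ?S" if "subfield T ?R \<and> card T = q" for T
      by (rule uniq[OF conjunct1[OF that] conjunct2[OF that]])
  qed
qed

section \<open>The embedding of rational functions\<close>

text \<open>\<open>'a ring_char\<close> is a type with exactly \<open>CHAR('a)\<close> elements, so this is the prime field of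
  characteristic \<open>CHAR('a)\<close>.\<close>

type_synonym 'a Fp = "'a ring_char mod_ring"

definition fp_embed :: "'a::field_prime_char Fp \<Rightarrow> 'a alg_closure" where
  "fp_embed x = of_int (to_int_mod_ring x)"

lemma fp_embed_add: "fp_embed (x + y) = fp_embed x + fp_embed y"
proof -
  have "fp_embed (x + y) = of_int ((to_int_mod_ring x + to_int_mod_ring y) mod int CHAR('a alg_closure))"
    by (simp only: fp_embed_def to_int_mod_ring_add CARD_ring_char CHAR_alg_closure)
  then show ?thesis by (simp only: of_int_mod_CHAR of_int_add fp_embed_def)
qed

lemma fp_embed_mult: "fp_embed (x * y) = fp_embed x * fp_embed y"
proof -
  have "fp_embed (x * y) = of_int ((to_int_mod_ring x * to_int_mod_ring y) mod int CHAR('a alg_closure))"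
    by (simp only: fp_embed_def to_int_mod_ring_mult CARD_ring_char CHAR_alg_closure)
  then show ?thesis by (simp only: of_int_mod_CHAR of_int_mult fp_embed_def)
qed

lemma fp_embed_0 [simp]: "fp_embed 0 = 0"
  by (simp add: fp_embed_def)

lemma fp_embed_1 [simp]: "fp_embed 1 = 1"
  by (simp add: fp_embed_def)

lemma fp_embed_eq_0_iff [simp]: "fp_embed x = 0 \<longleftrightarrow> x = 0"
proof
  assume "fp_embed x = 0"
  show "x = 0"
  proof (rule ccontr)
    assume "x \<noteq> 0"
    have "fp_embed x * fp_embed (inverse x) = 1"
      unfolding fp_embed_mult[symmetric] right_inverse[OF \<open>x \<noteq> 0\<close>] by (rule fp_embed_1)
    then show False using \<open>fp_embed x = 0\<close> by simp
  qed
qed simp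

text \<open>Substitution of the element \<open>t\<close> of the Hahn field for the variable.\<close>

definition fpx_embed :: "'a::field_prime_char Fp poly \<Rightarrow> 'a alg_closure hahn" where
  "fpx_embed g = poly (map_poly (\<lambda>c. hmonom (fp_embed c) 0) g) (hmonom 1 1)"

lemma const_embed_hom: "comm_ring_hom (\<lambda>c. hmonom (fp_embed c) 0 :: 'a::field_prime_char alg_closure hahn)"
proof
  fix x y :: "'a Fp"
  show "hmonom (fp_embed (x + y)) 0 = hmonom (fp_embed x) 0 + (hmonom (fp_embed y) 0 :: 'a alg_closure hahn)"
    by (simp only: fp_embed_add hmonom_add)
  show "hmonom (fp_embed (x * y)) 0 = hmonom (fp_embed x) 0 * (hmonom (fp_embed y) 0 :: 'a alg_closure hahn)"
    by (simp only: fp_embed_mult hmonom_mult add_0)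
qed (simp_all add: one_hahn_def)

lemma fpx_embed_mult: "fpx_embed (g * h) = fpx_embed g * fpx_embed h"
proof -
  interpret comm_ring_hom "\<lambda>c. hmonom (fp_embed c) 0 :: 'a alg_closure hahn"
    by (rule const_embed_hom)
  interpret m: map_poly_comm_ring_hom "\<lambda>c. hmonom (fp_embed c) 0 :: 'a alg_closure hahn" ..
  show ?thesis by (simp only: fpx_embed_def m.hom_mult poly_mult)
qed

lemma fpx_embed_add: "fpx_embed (g + h) = fpx_embed g + fpx_embed h"
proof -
  interpret comm_ring_hom "\<lambda>c. hmonom (fp_embed c) 0 :: 'a alg_closure hahn"
    by (rule const_embed_hom)
  interpret m: map_poly_comm_ring_hom "\<lambda>c. hmonom (fp_embed c) 0 :: 'a alg_closure hahn" ..
  show ?thesis by (simp only: fpx_embed_def m.hom_add poly_add)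
qed

lemma fpx_embed_1: "fpx_embed 1 = 1"
  by (simp add: fpx_embed_def one_hahn_def)

lemma hmonom_eq_0_iff: "hmonom c r = (0 :: 'b::comm_ring_1 hahn) \<longleftrightarrow> c = 0"
proof
  assume "hmonom c r = 0"
  then have "hcoeff (hmonom c r) r = 0" by (simp only: hcoeff_zero)
  then show "c = 0" by (simp add: hcoeff_hmonom)
qed simp

lemma hcoeff_fpx_embed: "hcoeff (fpx_embed g) (of_nat n) = fp_embed (coeff g n)"
proof -
  have deg: "degree (map_poly (\<lambda>c. hmonom (fp_embed c) 0 :: 'a alg_closure hahn) g) = degree g"
    by (rule degree_map_poly) (simp add: hmonom_eq_0_iff)
  have "fpx_embed g = (\<Sum>i\<le>degree g. hmonom (fp_embed (coeff g i)) (of_nat i))"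
    unfolding fpx_embed_def poly_altdef deg
    by (intro sum.cong refl) (simp add: coeff_map_poly hmonom_power hmonom_mult)
  then have "hcoeff (fpx_embed g) (of_nat n) =
      (\<Sum>i\<le>degree g. if i = n then fp_embed (coeff g i) else 0)"
    by (simp add: hcoeff_sum hcoeff_hmonom eq_commute)
  also have "\<dots> = fp_embed (coeff g n)"
    by (simp add: coeff_eq_0)
  finally show ?thesis .
qed

lemma fpx_embed_eq_0_iff [simp]: "fpx_embed g = 0 \<longleftrightarrow> g = 0"
proof
  assume "fpx_embed g = 0"
  then have "fp_embed (coeff g n) = 0" for n
    by (simp only: hcoeff_fpx_embed[symmetric] hcoeff_zero)
  then show "g = 0" by (intro poly_eqI) simp
qed (simp add: fpx_embed_def)

text \<open>A fraction goes to the quotient of the images of numerator and denominator; this does not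
  depend on the representing fraction (\<open>fpt_embed_Fract\<close>) and is a ring homomorphism.\<close>

definition fpt_embed :: "'a::field_prime_char Fp poly fract \<Rightarrow> 'a alg_closure hahn" where
  "fpt_embed r = (THE z. \<exists>g h. h \<noteq> 0 \<and> r = Fract g h \<and> z = fpx_embed g / fpx_embed h)"

lemma fpt_embed_Fract:
  assumes h: "h \<noteq> 0"
  shows "fpt_embed (Fract g h) = fpx_embed g / fpx_embed h"
  unfolding fpt_embed_def
proof (rule the_equality)
  show "\<exists>g' h'. h' \<noteq> 0 \<and> Fract g h = Fract g' h' \<and> fpx_embed g / fpx_embed h = fpx_embed g' / fpx_embed h'"
    using h by blast
  fix z assume "\<exists>g' h'. h' \<noteq> 0 \<and> Fract g h = Fract g' h' \<and> z = fpx_embed g' / fpx_embed h'"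
  then obtain g' h' where h': "h' \<noteq> 0" and eq: "Fract g h = Fract g' h'"
    and z: "z = fpx_embed g' / fpx_embed h'" by blast
  have nz: "fpx_embed h' \<noteq> 0" "fpx_embed h \<noteq> 0" using h h' by simp_all
  have "g' * h = g * h'" using eq eq_fract(1)[OF h h'] by simp
  then have "fpx_embed g' * fpx_embed h = fpx_embed g * fpx_embed h'"
    by (simp only: fpx_embed_mult[symmetric])
  then show "z = fpx_embed g / fpx_embed h"
    unfolding z by (rule iffD2[OF frac_eq_eq[OF nz]])
qed

lemma fpt_embed_hom: "comm_ring_hom (fpt_embed :: 'a::field_prime_char Fp poly fract \<Rightarrow> _)"
proof
  fix x y :: "'a Fp poly fract"
  obtain a b where x: "x = Fract a b" "b \<noteq> 0" by (cases x) auto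
  obtain c d where y: "y = Fract c d" "d \<noteq> 0" by (cases y) auto
  have bd: "b * d \<noteq> 0" using x y by simp
  have nz: "fpx_embed b \<noteq> 0" "fpx_embed d \<noteq> 0" using x y by simp_all
  have "fpt_embed (x + y) = fpx_embed (a * d + c * b) / fpx_embed (b * d)"
    unfolding x y add_fract[OF x(2) y(2)] by (rule fpt_embed_Fract[OF bd])
  also have "\<dots> = fpx_embed a / fpx_embed b + fpx_embed c / fpx_embed d"
    unfolding fpx_embed_add fpx_embed_mult add_frac_eq[OF nz] ..
  also have "\<dots> = fpt_embed x + fpt_embed y"
    unfolding x y fpt_embed_Fract[OF x(2)] fpt_embed_Fract[OF y(2)] ..
  finally show "fpt_embed (x + y) = fpt_embed x + fpt_embed y" .
  have "fpt_embed (x * y) = fpx_embed (a * c) / fpx_embed (b * d)"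
    unfolding x y mult_fract by (rule fpt_embed_Fract[OF bd])
  also have "\<dots> = (fpx_embed a / fpx_embed b) * (fpx_embed c / fpx_embed d)"
    unfolding fpx_embed_mult times_divide_times_eq ..
  also have "\<dots> = fpt_embed x * fpt_embed y"
    unfolding x y fpt_embed_Fract[OF x(2)] fpt_embed_Fract[OF y(2)] ..
  finally show "fpt_embed (x * y) = fpt_embed x * fpt_embed y" .
next
  show "fpt_embed (0 :: 'a Fp poly fract) = 0"
    unfolding Zero_fract_def by (simp add: fpt_embed_Fract)
  show "fpt_embed (1 :: 'a Fp poly fract) = 1"
    unfolding One_fract_def by (simp add: fpt_embed_Fract fpx_embed_1)
qed

section \<open>Algorithms: partial recursive functions\<close>

datatype recf =
    Zero
  | Succ
  | Proj nat
  | Comp recf "recf list"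
  | Prec recf recf
  | Mu recf

text \<open>\<open>rec_eval r xs y\<close>: on the arguments \<open>xs\<close> the program \<open>r\<close> halts with output \<open>y\<close>. The output is
  unique by \<open>rec_eval_deterministic\<close>. In \<open>Prec\<close> and \<open>Mu\<close> the recursion or search variable is the
  first argument; \<open>Mu\<close> requires the searched program to halt on all smaller values.\<close>

inductive rec_eval :: "recf \<Rightarrow> nat list \<Rightarrow> nat \<Rightarrow> bool" where
  Zero: "rec_eval Zero xs 0"
| Succ: "rec_eval Succ [x] (Suc x)"
| Proj: "i < length xs \<Longrightarrow> rec_eval (Proj i) xs (xs ! i)"
| Comp: "length ys = length gs \<Longrightarrow> (\<forall>i<length gs. rec_eval (gs ! i) xs (ys ! i)) \<Longrightarrow>
    rec_eval r ys z \<Longrightarrow> rec_eval (Comp r gs) xs z"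
| Prec_0: "rec_eval r xs z \<Longrightarrow> rec_eval (Prec r s) (0 # xs) z"
| Prec_Suc: "rec_eval (Prec r s) (n # xs) y \<Longrightarrow> rec_eval s (n # y # xs) z \<Longrightarrow>
    rec_eval (Prec r s) (Suc n # xs) z"
| Mu: "rec_eval r (n # xs) 0 \<Longrightarrow> (\<forall>i<n. \<exists>y. rec_eval r (i # xs) (Suc y)) \<Longrightarrow>
    rec_eval (Mu r) xs n"

lemma rec_eval_deterministic: "rec_eval r xs y \<Longrightarrow> rec_eval r xs z \<Longrightarrow> y = z"
proof (induction r xs y arbitrary: z rule: rec_eval.induct)
  case (Comp ys gs xs r y)
  from Comp.prems obtain us where us: "length us = length gs"
      "\<forall>i<length gs. rec_eval (gs ! i) xs (us ! i)" "rec_eval r us z"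
    by (cases rule: rec_eval.cases) auto
  have "ys = us"
    by (rule nth_equalityI) (use Comp.hyps Comp.IH us in auto)
  then show ?case using Comp.IH us by blast
next
  case (Prec_0 r xs y s)
  from Prec_0.prems have "rec_eval r xs z" by (cases rule: rec_eval.cases) auto
  then show ?case by (rule Prec_0.IH)
next
  case (Prec_Suc r s n xs u y)
  from Prec_Suc.prems obtain v where "rec_eval (Prec r s) (n # xs) v" "rec_eval s (n # v # xs) z"
    by (cases rule: rec_eval.cases) auto
  then show ?case using Prec_Suc.IH by blast
next
  case (Mu r n xs)
  from Mu.prems have z: "rec_eval r (z # xs) 0" "\<forall>i<z. \<exists>y. rec_eval r (i # xs) (Suc y)"
    by (cases rule: rec_eval.cases; auto)+
  have "\<not> n < z" using z(2) Mu.IH(1) by (metis nat.distinct(1))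
  moreover have "\<not> z < n" using z(1) Mu.IH(2) by (metis nat.distinct(1))
  ultimately show ?case by simp
qed (auto elim: rec_eval.cases)

section \<open>Codes of the inputs\<close>

definition fp_code :: "'p::prime_card mod_ring \<Rightarrow> nat" where
  "fp_code x = nat (to_int_mod_ring x)"

definition fpx_code :: "'p::prime_card mod_ring poly \<Rightarrow> nat" where
  "fpx_code g = list_encode (map fp_code (coeffs g))"

text \<open>A rational function may be presented by any numerator and nonzero denominator, not
  necessarily in lowest terms, so it has many codes.\<close>

definition is_fpt_code :: "'p::prime_card mod_ring poly fract \<Rightarrow> nat \<Rightarrow> bool" where
  "is_fpt_code r c \<longleftrightarrow> (\<exists>g h. h \<noteq> 0 \<and> r = Fract g h \<and> c = prod_encode (fpx_code g, fpx_code h))"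

definition is_fptx_code :: "'p::prime_card mod_ring poly fract poly \<Rightarrow> nat \<Rightarrow> bool" where
  "is_fptx_code f c \<longleftrightarrow> (\<exists>cs. list_all2 is_fpt_code (coeffs f) cs \<and> c = list_encode cs)"

end

theory Submission
  imports Defs
begin

text \<open>
  Raising every coefficient to the \<open>p\<close>-th power is an injective ring endomorphism of the Hahn field
  over \<open>\<overline>F\<close>, because \<open>c \<mapsto> c\<^sup>p\<close> is additive in characteristic \<open>p\<close>. It fixes \<open>t\<close> and the prime
  field, hence all of \<open>F\<^sub>p(t)\<close>, and therefore permutes the roots of \<open>f\<close>. There are at most
  \<open>d = degree f\<close> of these, so each root is a periodic point with period at most \<open>d\<close>, and the
  \<open>d!\<close>-fold iterate fixes all of them (\<open>roots_fixed_by_iterated_endomorphism\<close>). A series fixed by the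
  \<open>m\<close>-fold iterate has only coefficients with \<open>c ^ (p ^ m) = c\<close>, that is, coefficients in the field
  with \<open>p\<^sup>m\<close> elements.

  So \<open>m = d!\<close> works for every \<open>f\<close> of degree \<open>d\<close>, and the algorithm only has to read the degree off
  the code. The code of \<open>f\<close> is that of its list of coefficients, whichever fractions represent
  them, and this list has length \<open>d + 1\<close>. A program finds the length by counting how often the
  tail can be taken before the empty list, whose code is \<open>0\<close>, is reached; what remains is
  a predecessor and a factorial.
\<close>

section \<open>The coefficientwise Frobenius endomorphism\<close>

lift_definition hahn_frobenius :: "'k::field_prime_char hahn \<Rightarrow> 'k hahn"
  is "\<lambda>f q. f q ^ CHAR('k)"
  by simp

lemma hcoeff_frobenius: "hcoeff (hahn_frobenius (x :: 'k::field_prime_char hahn)) q = hcoeff x q ^ CHAR('k)"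
  by (simp add: hahn_frobenius.rep_eq)

lemma hcoeff_frobenius_funpow:
  "hcoeff ((hahn_frobenius ^^ m) (x :: 'k::field_prime_char hahn)) q = hcoeff x q ^ (CHAR('k) ^ m)"
  by (induction m) (simp_all add: hcoeff_frobenius flip: power_mult power_Suc2)

lemma prime_CHAR_field: "prime CHAR('k::field_prime_char)"
  by (rule prime_CHAR_semidom) simp

lemma hahn_frobenius_hmonom:
  "hahn_frobenius (hmonom (c :: 'k::field_prime_char) r) = hmonom (c ^ CHAR('k)) r"
  by (rule hahn_eqI) (simp add: hcoeff_frobenius hcoeff_hmonom)

lemma hahn_frobenius_field_hom: "field_hom (hahn_frobenius :: 'k::field_prime_char hahn \<Rightarrow> _)"
proof
  fix x y :: "'k hahn"
  have dream: "(a + b) ^ CHAR('k) = a ^ CHAR('k) + b ^ CHAR('k)" for a b :: 'k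
    by (rule freshmans_dream[OF prime_CHAR_field refl])
  show "hahn_frobenius (x + y) = hahn_frobenius x + hahn_frobenius y"
    by (rule hahn_eqI) (simp add: hcoeff_frobenius dream)
  \<comment> \<open>The \<open>p\<close>-th power of a coefficient vanishes only with it, so both convolutions are finite sums
    over the same pairs of exponents and agree term by term.\<close>
  have "conv (hcoeff x) (hcoeff y) q ^ CHAR('k) =
      conv (hcoeff (hahn_frobenius x)) (hcoeff (hahn_frobenius y)) q" for q
    unfolding conv_def freshmans_dream_sum[OF prime_CHAR_field refl]
    by (rule sum.cong) (auto simp: hcoeff_frobenius power_mult_distrib)
  then show "hahn_frobenius (x * y) = hahn_frobenius x * hahn_frobenius y"
    by (intro hahn_eqI) (simp add: hcoeff_frobenius hcoeff_mult)
qed (simp_all add: one_hahn_def hahn_frobenius_hmonom, simp add: hahn_eqI hcoeff_frobenius)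

interpretation hahn_frobenius: field_hom "hahn_frobenius :: 'k::field_prime_char hahn \<Rightarrow> _"
  by (rule hahn_frobenius_field_hom)

text \<open>Fermat's little theorem in a field of characteristic \<open>p\<close>: additivity of the \<open>p\<close>-th power
  carries the equation from \<open>0\<close> along the integers in both directions.\<close>

lemma of_int_power_CHAR: "(of_int i :: 'k::field_prime_char) ^ CHAR('k) = of_int i"
proof (induction i rule: int_induct[where k = 0])
  case base
  show ?case by simp
next
  case (step1 i)
  then show ?case
    by (simp add: freshmans_dream[OF prime_CHAR_field refl])
next
  case (step2 i)
  have "(of_int (i - 1) + 1 :: 'k) ^ CHAR('k) = of_int (i - 1) ^ CHAR('k) + 1"
    by (simp only: freshmans_dream[OF prime_CHAR_field refl] power_one)
  then show ?case using step2 by (simp add: algebra_simps)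
qed

lemma hahn_frobenius_fpx_embed: "hahn_frobenius (fpx_embed g) = fpx_embed g"
proof -
  let ?P = "map_poly (\<lambda>c. hmonom (fp_embed c) 0) g"
  have t: "hahn_frobenius (hmonom 1 1) = (hmonom 1 1 :: 'a alg_closure hahn)"
    by (simp add: hahn_frobenius_hmonom)
  have "map_poly hahn_frobenius ?P = ?P"
    by (rule poly_eqI)
       (simp add: coeff_map_poly hahn_frobenius_hmonom fp_embed_def of_int_power_CHAR del: CHAR_alg_closure)
  then show ?thesis
    unfolding fpx_embed_def by (metis hahn_frobenius.poly_map_poly t)
qed

lemma hahn_frobenius_fpt_embed: "hahn_frobenius (fpt_embed r) = fpt_embed r"
proof (cases r)
  case (Fract g h)
  then show ?thesis
    by (simp add: fpt_embed_Fract hahn_frobenius.hom_div hahn_frobenius_fpx_embed)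
qed

section \<open>Periods of an injective map on a finite set\<close>

text \<open>Two of the \<open>d + 1\<close> points \<open>x, \<sigma> x, \<dots>, \<sigma>\<^sup>d x\<close> coincide, which by injectivity gives a period
  \<open>k \<le> d\<close> of \<open>x\<close> itself, and every such \<open>k\<close> divides \<open>d!\<close>.\<close>

lemma funpow_fact_fixes:
  assumes inj: "inj \<sigma>" and R: "finite R" "card R \<le> d" and closed: "\<And>x. x \<in> R \<Longrightarrow> \<sigma> x \<in> R"
    and x: "x \<in> R"
  shows "(\<sigma> ^^ fact d) x = x"
proof -
  have mem: "(\<sigma> ^^ k) x \<in> R" for k
    by (induction k) (simp_all add: x closed)
  have "\<not> inj_on (\<lambda>k. (\<sigma> ^^ k) x) {..d}"
  proof
    assume "inj_on (\<lambda>k. (\<sigma> ^^ k) x) {..d}"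
    then have "card {..d} \<le> card R"
      by (rule card_inj_on_le) (use mem R in auto)
    then show False using R by simp
  qed
  then obtain i j where ij: "i < j" "j \<le> d" "(\<sigma> ^^ i) x = (\<sigma> ^^ j) x"
    unfolding inj_on_def by (metis atMost_iff linorder_neqE_nat)
  define k where "k = j - i"
  have "(\<sigma> ^^ i) ((\<sigma> ^^ k) x) = (\<sigma> ^^ i) x"
    using ij by (simp add: k_def flip: funpow_add[THEN fun_cong, unfolded o_apply])
  then have period: "(\<sigma> ^^ k) x = x"
    using inj_fn[OF inj] by (simp add: inj_eq)
  have "k dvd fact d"
    by (rule dvd_fact) (use ij in \<open>simp_all add: k_def\<close>)
  then obtain l where l: "fact d = k * l" ..
  have "((\<sigma> ^^ k) ^^ l) x = x"
    by (induction l) (simp_all add: period)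
  then show ?thesis by (simp add: l funpow_mult)
qed

text \<open>An endomorphism that fixes the coefficients of \<open>P\<close> maps its finite set of roots into itself, and
  between fields it is injective.\<close>

lemma roots_fixed_by_iterated_endomorphism:
  fixes P :: "'b::field poly"
  assumes \<sigma>: "field_hom \<sigma>" and fixed: "map_poly \<sigma> P = P" and P: "P \<noteq> 0" and x: "poly P x = 0"
  shows "(\<sigma> ^^ fact (degree P)) x = x"
proof (rule funpow_fact_fixes)
  interpret field_hom \<sigma> by (rule \<sigma>)
  show "inj \<sigma>" by (auto intro: injI injectivity)
  show "finite {y. poly P y = 0}" "card {y. poly P y = 0} \<le> degree P"
    using P by (simp_all add: poly_roots_finite card_poly_roots_bound)
  show "\<sigma> y \<in> {y. poly P y = 0}" if "y \<in> {y. poly P y = 0}" for y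
  proof -
    have "poly (map_poly \<sigma> P) (\<sigma> y) = 0" using that by simp
    then show ?thesis by (simp only: fixed mem_Collect_eq)
  qed
qed (simp add: x)

lemma root_coefficients_in_finite_field:
  fixes f :: "'a::field_prime_char Fp poly fract poly" and x :: "'a alg_closure hahn"
  assumes f: "f \<noteq> 0" and x: "poly (map_poly fpt_embed f) x = 0"
  shows "x \<in> hahn_over (subfield_of_card (CHAR('a) ^ fact (degree f)))"
proof -
  let ?P = "map_poly fpt_embed f :: 'a alg_closure hahn poly"
  interpret fpt_embed: field_hom "fpt_embed :: 'a Fp poly fract \<Rightarrow> _"
  proof -
    interpret comm_ring_hom "fpt_embed :: 'a Fp poly fract \<Rightarrow> _" by (rule fpt_embed_hom)
    show "field_hom (fpt_embed :: 'a Fp poly fract \<Rightarrow> _)" ..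
  qed
  have "map_poly hahn_frobenius ?P = ?P"
    by (rule poly_eqI) (simp add: coeff_map_poly hahn_frobenius_fpt_embed)
  moreover have "?P \<noteq> 0" using f by simp
  ultimately have "(hahn_frobenius ^^ fact (degree ?P)) x = x"
    using x by (intro roots_fixed_by_iterated_endomorphism hahn_frobenius_field_hom)
  then have "hcoeff x q ^ (CHAR('a alg_closure) ^ fact (degree f)) = hcoeff x q" for q
    by (simp del: CHAR_alg_closure flip: hcoeff_frobenius_funpow)
  moreover have "subfield_of_card (CHAR('a) ^ fact (degree f)) =
      {c :: 'a alg_closure. c ^ (CHAR('a) ^ fact (degree f)) = c}"
    by (rule subfield_of_card_eq(1)[of "fact (degree f)"]) simp_all
  ultimately show ?thesis
    by (simp add: hahn_over_def)
qed

section \<open>Recursive programs for the length of a list and the factorial\<close>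

lemma rec_eval_Comp1: "rec_eval g xs a \<Longrightarrow> rec_eval r [a] z \<Longrightarrow> rec_eval (Comp r [g]) xs z"
  by (rule rec_eval.Comp[of "[a]"]) simp_all

lemma rec_eval_Comp2:
  "rec_eval g xs a \<Longrightarrow> rec_eval h xs b \<Longrightarrow> rec_eval r [a, b] z \<Longrightarrow> rec_eval (Comp r [g, h]) xs z"
  by (rule rec_eval.Comp[of "[a, b]"]) (simp_all add: less_Suc_eq)

lemma rec_eval_Proj_0: "rec_eval (Proj 0) (x # xs) x"
  using rec_eval.Proj[of 0 "x # xs"] by simp

lemma rec_eval_Proj_1: "rec_eval (Proj 1) (x # y # xs) y"
  using rec_eval.Proj[of 1 "x # y # xs"] by simp

lemma rec_eval_Proj_2: "rec_eval (Proj 2) (x # y # z # xs) z"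
  using rec_eval.Proj[of 2 "x # y # z # xs"] by simp

lemmas rec_eval_basic =
  rec_eval_Comp1 rec_eval_Comp2 rec_eval_Proj_0 rec_eval_Proj_1 rec_eval_Proj_2

definition "prog_add = Prec (Proj 0) (Comp Succ [Proj 1])"

lemma rec_eval_add: "rec_eval prog_add [n, x] (n + x)"
  unfolding prog_add_def
proof (induction n)
  case (Suc n)
  show ?case unfolding add_Suc
    by (rule rec_eval.Prec_Suc[OF Suc], (rule rec_eval_basic rec_eval.Succ)+)
qed (simp add: rec_eval.Prec_0 rec_eval_Proj_0)

definition "prog_mult = Prec Zero (Comp prog_add [Proj 2, Proj 1])"

lemma rec_eval_mult: "rec_eval prog_mult [n, x] (n * x)"
  unfolding prog_mult_def
proof (induction n)
  case (Suc n)
  show ?case unfolding mult_Suc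
    by (rule rec_eval.Prec_Suc[OF Suc], (rule rec_eval_basic rec_eval_add)+)
qed (auto intro: rec_eval.Prec_0 rec_eval.Zero)

definition "prog_pred = Prec Zero (Proj 0)"

lemma rec_eval_pred: "rec_eval prog_pred [n] (n - 1)"
  unfolding prog_pred_def
proof (induction n)
  case (Suc n)
  show ?case unfolding diff_Suc_1
    by (rule rec_eval.Prec_Suc[OF Suc]) (rule rec_eval_basic)
qed (auto intro: rec_eval.Prec_0 rec_eval.Zero)

text \<open>Recursion is on the first argument, which is therefore the number to be subtracted.\<close>

definition "prog_diff = Prec (Proj 0) (Comp prog_pred [Proj 1])"

lemma rec_eval_diff: "rec_eval prog_diff [n, x] (x - n)"
  unfolding prog_diff_def
proof (induction n)
  case (Suc n)
  have "x - Suc n = x - n - 1" by simp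
  then show ?case
    by (simp only:) (rule rec_eval.Prec_Suc[OF Suc], (rule rec_eval_basic rec_eval_pred)+)
qed (simp add: rec_eval.Prec_0 rec_eval_Proj_0)

definition "prog_fact = Prec (Comp Succ [Zero]) (Comp prog_mult [Comp Succ [Proj 0], Proj 1])"

lemma rec_eval_fact: "rec_eval prog_fact [n] (fact n)"
  unfolding prog_fact_def
proof (induction n)
  case 0
  show ?case unfolding fact_0 One_nat_def
    by (rule rec_eval.Prec_0 rec_eval_basic rec_eval.Zero rec_eval.Succ)+
next
  case (Suc n)
  show ?case unfolding fact_Suc of_nat_id
    by (rule rec_eval.Prec_Suc[OF Suc], (rule rec_eval_basic rec_eval_mult rec_eval.Succ)+)
qed

definition "prog_triangle = Prec Zero (Comp prog_add [Proj 1, Comp Succ [Proj 0]])"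

lemma rec_eval_triangle: "rec_eval prog_triangle [n] (triangle n)"
  unfolding prog_triangle_def
proof (induction n)
  case (Suc n)
  show ?case unfolding triangle_Suc
    by (rule rec_eval.Prec_Suc[OF Suc], (rule rec_eval_basic rec_eval_add rec_eval.Succ)+)
qed (auto intro: rec_eval.Prec_0 rec_eval.Zero)

text \<open>The code of a nonempty list is \<open>triangle (a + b) + a + 1\<close>, where \<open>a\<close> is the head and \<open>b\<close> the
  code of the tail. It lies above \<open>triangle (a + b)\<close> and falls short of the next triangular number
  \<open>triangle (a + b) + a + b + 1\<close> by exactly \<open>b\<close>. So the tail is found as the distance to the least
  triangular number that is not smaller than the code.\<close>

definition triangle_index :: "nat \<Rightarrow> nat" where
  "triangle_index c = (LEAST s. c \<le> triangle s)"

definition tail_code :: "nat \<Rightarrow> nat" where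
  "tail_code c = triangle (triangle_index c) - c"

lemma mono_triangle: "i \<le> j \<Longrightarrow> triangle i \<le> triangle j"
  by (rule lift_Suc_mono_le[of triangle]) simp_all

lemma le_triangle_index: "c \<le> triangle (triangle_index c)"
  unfolding triangle_index_def
proof (rule LeastI)
  show "c \<le> triangle c" by (induction c) simp_all
qed

lemma tail_code_Cons: "tail_code (list_encode (x # xs)) = list_encode xs"
proof -
  let ?c = "list_encode (x # xs)" and ?b = "list_encode xs"
  have c: "?c = Suc (triangle (x + ?b) + x)"
    by (simp add: prod_encode_def)
  have "triangle_index ?c = Suc (x + ?b)"
    unfolding triangle_index_def
  proof (rule Least_equality)
    show "?c \<le> triangle (Suc (x + ?b))" unfolding c triangle_Suc by simp
    show "Suc (x + ?b) \<le> s" if "?c \<le> triangle s" for s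
    proof (rule ccontr)
      assume "\<not> Suc (x + ?b) \<le> s"
      then have "triangle s \<le> triangle (x + ?b)" by (intro mono_triangle) simp
      then show False using that unfolding c by simp
    qed
  qed
  then show ?thesis unfolding tail_code_def c triangle_Suc by simp
qed

lemma tail_code_0: "tail_code 0 = 0"
  by (simp add: tail_code_def triangle_index_def)

lemma tail_code_funpow: "(tail_code ^^ n) (list_encode xs) = list_encode (drop n xs)"
proof (induction n arbitrary: xs)
  case (Suc n)
  have "tail_code (list_encode xs) = list_encode (tl xs)"
    by (cases xs) (simp_all add: tail_code_Cons tail_code_0 del: list_encode.simps(2))
  then show ?case by (simp only: funpow_Suc_right o_apply Suc drop_Suc)
qed simp

definition "prog_tail = Comp prog_diff
  [Proj 0, Comp prog_triangle [Mu (Comp prog_diff [Comp prog_triangle [Proj 0], Proj 1])]]"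

lemma rec_eval_tail: "rec_eval prog_tail [c] (tail_code c)"
proof -
  let ?r = "Comp prog_diff [Comp prog_triangle [Proj 0], Proj 1]"
  have r: "rec_eval ?r [s, c] (c - triangle s)" for s
    by (rule rec_eval_basic rec_eval_diff rec_eval_triangle)+
  have index: "rec_eval (Mu ?r) [c] (triangle_index c)"
  proof (rule rec_eval.Mu)
    show "rec_eval ?r [triangle_index c, c] 0"
      using r[of "triangle_index c"] by (simp add: le_triangle_index)
    show "\<forall>i<triangle_index c. \<exists>y. rec_eval ?r [i, c] (Suc y)"
    proof (intro allI impI)
      fix i assume "i < triangle_index c"
      then have "\<not> c \<le> triangle i" unfolding triangle_index_def by (rule not_less_Least)
      then have "c - triangle i = Suc (c - triangle i - 1)" by simp
      then show "\<exists>y. rec_eval ?r [i, c] (Suc y)" using r[of i] by metis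
    qed
  qed
  show ?thesis
    unfolding prog_tail_def tail_code_def
    by (rule index rec_eval_basic rec_eval_diff rec_eval_triangle)+
qed

definition "prog_drop = Prec (Proj 0) (Comp prog_tail [Proj 1])"

lemma rec_eval_drop: "rec_eval prog_drop [n, c] ((tail_code ^^ n) c)"
  unfolding prog_drop_def
proof (induction n)
  case (Suc n)
  show ?case unfolding funpow.simps o_apply
    by (rule rec_eval.Prec_Suc[OF Suc], (rule rec_eval_basic rec_eval_tail)+)
qed (simp add: rec_eval.Prec_0 rec_eval_Proj_0)

text \<open>Every nonempty suffix has a code of the form \<open>Suc y\<close>, so the search for the
  first \<open>0\<close> is defined all the way and stops exactly at the length.\<close>

lemma rec_eval_length: "rec_eval (Mu prog_drop) [list_encode xs] (length xs)"
proof (rule rec_eval.Mu)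
  show "rec_eval prog_drop [length xs, list_encode xs] 0"
    using rec_eval_drop[of "length xs" "list_encode xs"] by (simp add: tail_code_funpow)
  show "\<forall>i<length xs. \<exists>y. rec_eval prog_drop [i, list_encode xs] (Suc y)"
  proof (intro allI impI)
    fix i assume "i < length xs"
    then have "list_encode (drop i xs) = Suc (prod_encode (xs ! i, list_encode (drop (Suc i) xs)))"
      by (simp flip: Cons_nth_drop_Suc)
    then show "\<exists>y. rec_eval prog_drop [i, list_encode xs] (Suc y)"
      using rec_eval_drop[of i "list_encode xs"] unfolding tail_code_funpow by auto
  qed
qed

text \<open>The output does not depend on the fractions chosen for the coefficients: only the number of
  entries of the coded list enters.\<close>

lemma rec_eval_fact_degree:
  assumes "f \<noteq> 0" "is_fptx_code f c"
  shows "rec_eval (Comp prog_fact [Comp prog_pred [Mu prog_drop]]) [c] (fact (degree f))"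
proof -
  obtain cs where cs: "list_all2 is_fpt_code (coeffs f) cs" "c = list_encode cs"
    using assms(2) unfolding is_fptx_code_def by blast
  have "length cs - 1 = degree f"
    using list_all2_lengthD[OF cs(1)] assms(1) by (simp add: length_coeffs_degree)
  then have "rec_eval (Comp prog_pred [Mu prog_drop]) [c] (degree f)"
    unfolding cs(2) by (metis rec_eval_Comp1 rec_eval_length rec_eval_pred)
  then show ?thesis by (rule rec_eval_Comp1[OF _ rec_eval_fact])
qed

section \<open>A computable bound for the coefficient field of the roots\<close>

theorem corollary5p7:
  shows "\<exists>A. \<forall>f :: 'a::field_prime_char Fp poly fract poly. f \<noteq> 0 \<longrightarrow>
    (\<exists>m>0. (\<forall>c. is_fptx_code f c \<longrightarrow> rec_eval A [c] m) \<and>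
      (\<forall>x :: 'a alg_closure hahn. poly (map_poly fpt_embed f) x = 0 \<longrightarrow>
        x \<in> hahn_over (subfield_of_card (CHAR('a) ^ m))))"
proof (rule exI, intro allI impI)
  fix f :: "'a Fp poly fract poly"
  assume f: "f \<noteq> 0"
  show "\<exists>m>0. (\<forall>c. is_fptx_code f c \<longrightarrow>
        rec_eval (Comp prog_fact [Comp prog_pred [Mu prog_drop]]) [c] m) \<and>
      (\<forall>x :: 'a alg_closure hahn. poly (map_poly fpt_embed f) x = 0 \<longrightarrow>
        x \<in> hahn_over (subfield_of_card (CHAR('a) ^ m)))"
    using rec_eval_fact_degree[OF f] root_coefficients_in_finite_field[OF f]
    by (intro exI[of _ "fact (degree f)"]) simp
qed

end
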